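(* Let $f_1\in\mathcal F_{\mu_1,L_1}$ and $f_2\in\mathcal F_{\mu_2,L_2}$ be functions on $\mathbb R^d$ satisfying the standing assumption (A) of the context, with $L_2>\mu_1>0$, $\mu_2\in\big[\frac{-L_2\mu_1}{L_2+\mu_1},0\big)$ and $\mu_1+\mu_2>0$, and let $F=f_1-f_2$. Consider two DCA iterations connecting $x^k$, $x^{k+1}$ and $x^{k+2}$ (with $x^k\in\operatorname{dom}\partial f_1$). Then $$F(x^k)-F(x^{k+1})\;\ge\;\Big(\mu_1+\frac{L_2\mu_2}{L_2+\mu_2}\Big)\frac12\|x^k-x^{k+1}\|^2+\frac{\mu_1^2}{2(L_2+\mu_2)}\|x^{k+1}-x^{k+2}\|^2 .$$
   Context: Function class. For $\mu\in\mathbb R$ and $L\in(\mu,\infty]$, $\mathcal F_{\mu,L}$ denotes the set of proper, lower semicontinuous functions $f:\mathbb R^d\to\mathbb R\cup\{+\infty\}$ such that $f-\frac{\mu}{2}\|\cdot\|^2$ is convex and, if $L<\infty$, $f$ is finite-valued and $\frac L2\|\cdot\|^2-f$ is convex (no condition on the upper curvature if $L=\infty$). Expressions in which some $L_i=\infty$ are understood as limits $L_i\to\infty$. Subdifferential. For convex $f$, $\partial f(x)$ is the usual convex subdifferential. For $f\in\mathcal F_{\mu,L}$ with $\mu<0$, $\partial f(x):=\partial\tilde f(x)+\mu x$ where $\tilde f=f-\frac\mu2\|\cdot\|^2$ is convex. $\operatorname{dom}\partial f=\{x:\partial f(x)\ne\emptyset\}$ and $\operatorname{range}\partial f=\bigcup_x\partial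 f(x)$. Standing assumption (A). $f_1\in\mathcal F_{\mu_1,L_1}$ and $f_2\in\mathcal F_{\mu_2,L_2}$ with $0\le\mu_1<L_1\le\infty$, $\mu_2\in(-\infty,\infty)$, $L_2\in(\mu_2,\infty]$; $F=f_1-f_2$ (with the convention $(+\infty)-(+\infty)=+\infty$) is bounded below; $\emptyset\ne\operatorname{dom}\partial f_1\subseteq\operatorname{dom}\partial f_2$ and $\operatorname{range}\partial f_2\subseteq\operatorname{range}\partial f_1$. DCA (difference-of-convex algorithm). Given $x^k$, one iteration selects any $g_2^k\in\partial f_2(x^k)$ and any $x^{k+1}\in\arg\min_{w\in\mathbb R^d}\{f_1(w)-\langle g_2^k,w\rangle\}$. *)

theory Defs
  imports "HOL-Analysis.Analysis" "HOL-Real_Asymp.Real_Asymp"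
begin

definition proper_fun :: "('a \<Rightarrow> ereal) \<Rightarrow> bool" where
  "proper_fun f \<longleftrightarrow> (\<forall>x. f x \<noteq> -\<infinity>) \<and> (\<exists>x. f x \<noteq> \<infinity>)"

definition lsc_fun :: "('a::topological_space \<Rightarrow> ereal) \<Rightarrow> bool" where
  "lsc_fun f \<longleftrightarrow> (\<forall>x. f x \<le> Liminf (at x) f)"

text \<open>Jensen's inequality for extended-valued functions; it is only applied to functions
  that never take the value \<open>-\<infinity>\<close>, so that the right-hand side contains
  no \<open>\<infinity> - \<infinity>\<close>.\<close>

definition econvex :: "('a::real_vector \<Rightarrow> ereal) \<Rightarrow> bool" where
  "econvex f \<longleftrightarrow> (\<forall>x y. \<forall>t\<in>{0<..<1}.
     f ((1 - t) *\<^sub>R x + t *\<^sub>R y) \<le> ereal (1 - t) * f x + ereal t * f y)"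

definition quad :: "real \<Rightarrow> 'a::real_normed_vector \<Rightarrow> ereal" where
  "quad c x = ereal (c / 2 * (norm x)\<^sup>2)"

definition curv_class :: "real \<Rightarrow> ereal \<Rightarrow> ('a::euclidean_space \<Rightarrow> ereal) set" where
  "curv_class \<mu> L = {f. proper_fun f \<and> lsc_fun f \<and> econvex (\<lambda>x. f x - quad \<mu> x) \<and>
     (L < \<infinity> \<longrightarrow> (\<forall>x. \<bar>f x\<bar> \<noteq> \<infinity>) \<and> econvex (\<lambda>x. quad (real_of_ereal L) x - f x))}"

definition convex_subdiff :: "('a::real_inner \<Rightarrow> ereal) \<Rightarrow> 'a \<Rightarrow> 'a set" where
  "convex_subdiff f x = {g. \<forall>y. f x + ereal (g \<bullet> (y - x)) \<le> f y}"

text \<open>The subdifferential of a function in \<open>curv_class \<mu> L\<close>. The lower curvature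
  \<open>\<mu>\<close> is a parameter because for \<open>\<mu> < 0\<close> the subdifferential is
  defined through the convex function \<open>f - \<mu>/2 \<parallel>\<cdot>\<parallel>\<^sup>2\<close>.\<close>

definition subdiff :: "real \<Rightarrow> ('a::real_inner \<Rightarrow> ereal) \<Rightarrow> 'a \<Rightarrow> 'a set" where
  "subdiff \<mu> f x =
     (if \<mu> < 0 then (\<lambda>g. g + \<mu> *\<^sub>R x) ` convex_subdiff (\<lambda>w. f w - quad \<mu> w) x
      else convex_subdiff f x)"

definition dom_subdiff :: "real \<Rightarrow> ('a::real_inner \<Rightarrow> ereal) \<Rightarrow> 'a set" where
  "dom_subdiff \<mu> f = {x. subdiff \<mu> f x \<noteq> {}}"

definition range_subdiff :: "real \<Rightarrow> ('a::real_inner \<Rightarrow> ereal) \<Rightarrow> 'a set" where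
  "range_subdiff \<mu> f = (\<Union>x. subdiff \<mu> f x)"

text \<open>On \<^typ>\<open>ereal\<close>, \<open>\<infinity> - \<infinity> = \<infinity>\<close>, which is the usual
  convention for differences of convex functions.\<close>

definition dc_obj :: "('a \<Rightarrow> ereal) \<Rightarrow> ('a \<Rightarrow> ereal) \<Rightarrow> 'a \<Rightarrow> ereal" where
  "dc_obj f\<^sub>1 f\<^sub>2 x = f\<^sub>1 x - f\<^sub>2 x"

lemma dc_obj_infinity: "f\<^sub>1 x = \<infinity> \<Longrightarrow> dc_obj f\<^sub>1 f\<^sub>2 x = \<infinity>"
  by (simp add: dc_obj_def)

definition dc_assumption ::
  "real \<Rightarrow> ereal \<Rightarrow> ('a::euclidean_space \<Rightarrow> ereal) \<Rightarrow> real \<Rightarrow> ereal \<Rightarrow> ('a \<Rightarrow> ereal) \<Rightarrow> bool" where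
  "dc_assumption \<mu>\<^sub>1 L\<^sub>1 f\<^sub>1 \<mu>\<^sub>2 L\<^sub>2 f\<^sub>2 \<longleftrightarrow>
     f\<^sub>1 \<in> curv_class \<mu>\<^sub>1 L\<^sub>1 \<and> f\<^sub>2 \<in> curv_class \<mu>\<^sub>2 L\<^sub>2 \<and>
     0 \<le> \<mu>\<^sub>1 \<and> ereal \<mu>\<^sub>1 < L\<^sub>1 \<and> ereal \<mu>\<^sub>2 < L\<^sub>2 \<and>
     (\<exists>m::real. \<forall>x. ereal m \<le> dc_obj f\<^sub>1 f\<^sub>2 x) \<and>
     dom_subdiff \<mu>\<^sub>1 f\<^sub>1 \<noteq> {} \<and> dom_subdiff \<mu>\<^sub>1 f\<^sub>1 \<subseteq> dom_subdiff \<mu>\<^sub>2 f\<^sub>2 \<and>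
     range_subdiff \<mu>\<^sub>2 f\<^sub>2 \<subseteq> range_subdiff \<mu>\<^sub>1 f\<^sub>1"

definition dca_step ::
  "('a::real_inner \<Rightarrow> ereal) \<Rightarrow> real \<Rightarrow> ('a \<Rightarrow> ereal) \<Rightarrow> 'a \<Rightarrow> 'a \<Rightarrow> bool" where
  "dca_step f\<^sub>1 \<mu>\<^sub>2 f\<^sub>2 x x' \<longleftrightarrow>
     (\<exists>g \<in> subdiff \<mu>\<^sub>2 f\<^sub>2 x. is_arg_min (\<lambda>w. f\<^sub>1 w - ereal (g \<bullet> w)) (\<lambda>_. True) x')"

text \<open>An expression \<open>h\<close> in an upper curvature \<open>L\<close> is read as its limit
  when \<open>L = \<infinity>\<close>. The lemmas below confirm that the limits in question exist.\<close>

definition at_curv :: "ereal \<Rightarrow> (real \<Rightarrow> real) \<Rightarrow> real" where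
  "at_curv L h = (if L = \<infinity> then Lim at_top h else h (real_of_ereal L))"

lemma at_curv_ereal [simp]: "at_curv (ereal L) h = h L"
  by (simp add: at_curv_def)

lemma at_curv_infinity: "(h \<longlongrightarrow> l) at_top \<Longrightarrow> at_curv \<infinity> h = l"
  by (simp add: at_curv_def tendsto_Lim)

lemma at_curv_infinity_lower: "at_curv \<infinity> (\<lambda>L. - L * \<mu> / (L + \<mu>)) = - \<mu>"
  by (rule at_curv_infinity) real_asymp

lemma at_curv_infinity_decrease:
  "at_curv \<infinity> (\<lambda>L. (\<mu> + L * \<nu> / (L + \<nu>)) * (1 / 2) * a + \<mu>\<^sup>2 / (2 * (L + \<nu>)) * b)
     = (\<mu> + \<nu>) * (1 / 2) * a"
proof (rule at_curv_infinity)
  have "((\<lambda>L. L * \<nu> / (L + \<nu>)) \<longlongrightarrow> \<nu>) at_top" by real_asymp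
  moreover have "((\<lambda>L. \<mu>\<^sup>2 / (2 * (L + \<nu>))) \<longlongrightarrow> 0) at_top" by real_asymp
  ultimately have "((\<lambda>L. (\<mu> + L * \<nu> / (L + \<nu>)) * (1 / 2) * a + \<mu>\<^sup>2 / (2 * (L + \<nu>)) * b)
      \<longlongrightarrow> (\<mu> + \<nu>) * (1 / 2) * a + 0 * b) at_top"
    by (intro tendsto_intros)
  then show "((\<lambda>L. (\<mu> + L * \<nu> / (L + \<nu>)) * (1 / 2) * a + \<mu>\<^sup>2 / (2 * (L + \<nu>)) * b)
      \<longlongrightarrow> (\<mu> + \<nu>) * (1 / 2) * a) at_top"
    by simp
qed

end

theory Submission
  imports Defs
begin

text \<open>Write \<open>g\<^sub>0 \<in> \<partial>f\<^sub>2(x\<^sub>0) \<inter> \<partial>f\<^sub>1(x\<^sub>1)\<close> and \<open>g\<^sub>1 \<in> \<partial>f\<^sub>2(x\<^sub>1) \<inter> \<partial>f\<^sub>1(x\<^sub>2)\<close> for the subgradients of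
  the two steps, \<open>X = x\<^sub>1 - x\<^sub>0\<close>, \<open>G = g\<^sub>1 - g\<^sub>0\<close>. Strong convexity of \<open>f\<^sub>1\<close> bounds
  \<open>f\<^sub>1(x\<^sub>0) - f\<^sub>1(x\<^sub>1)\<close> from below by \<open>-g\<^sub>0 \<bullet> X + \<mu>\<^sub>1/2 \<parallel>X\<parallel>\<^sup>2\<close>, and gives \<open>\<parallel>G\<parallel> \<ge> \<mu>\<^sub>1 \<parallel>x\<^sub>2 - x\<^sub>1\<parallel>\<close>.
  For finite \<open>L\<^sub>2\<close> the interpolation inequality for \<open>f\<^sub>2\<close>, used once in each direction, first gives
  \<open>(L\<^sub>2 + \<mu>\<^sub>2) G \<bullet> X \<ge> \<parallel>G\<parallel>\<^sup>2 + \<mu>\<^sub>2 L\<^sub>2 \<parallel>X\<parallel>\<^sup>2\<close> and then, as \<open>\<mu>\<^sub>2 \<le> 0\<close>,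
  \<open>2 (L\<^sub>2 + \<mu>\<^sub>2) (f\<^sub>2(x\<^sub>1) - f\<^sub>2(x\<^sub>0) - g\<^sub>0 \<bullet> X) \<ge> \<parallel>G\<parallel>\<^sup>2 + \<mu>\<^sub>2 L\<^sub>2 \<parallel>X\<parallel>\<^sup>2\<close>.
  For \<open>L\<^sub>2 = \<infinity>\<close> the lower curvature bound on \<open>f\<^sub>2\<close> alone suffices.\<close>

text \<open>Performs the limit \<open>t\<close> to 0 in inequalities tested along a segment and
  divided by \<open>t\<close>.\<close>

lemma le_of_le_add_mult_small:
  fixes a b c :: real
  assumes "\<And>t. 0 < t \<Longrightarrow> t < 1 \<Longrightarrow> a \<le> b + t * c"
  shows "a \<le> b"
proof (rule tendsto_lowerbound)
  show "((\<lambda>t. b + t * c) \<longlongrightarrow> b) (at_right 0)"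
    by (auto intro!: tendsto_eq_intros)
  show "\<forall>\<^sub>F t in at_right 0. a \<le> b + t * c"
    by (rule eventually_mono[OF eventually_at_right_real[of 0 1]]) (auto intro: assms)
qed simp

lemma subdiff_finite:
  assumes "proper_fun f" and "g \<in> subdiff \<mu> f x"
  shows "\<bar>f x\<bar> \<noteq> \<infinity>"
proof -
  from assms(1) obtain y where y: "f y \<noteq> \<infinity>" and ninf: "\<And>z. f z \<noteq> -\<infinity>"
    by (auto simp: proper_fun_def)
  from y ninf[of y] obtain b where b: "f y = ereal b" by (cases "f y") auto
  have "f x \<noteq> \<infinity>"
  proof
    assume "f x = \<infinity>"
    with assms(2) b show False
      by (auto simp: subdiff_def convex_subdiff_def quad_def split: if_splits dest!: spec[of _ y])
  qed
  with ninf[of x] show ?thesis by auto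
qed

text \<open>The plain subgradient inequality gains a quadratic term when it is tested at a point of
  the segment near \<open>x\<close> and compared with the convexity of \<open>f - quad c\<close> on
  that segment.\<close>

lemma strong_convex_subgradient_ge:
  fixes f :: "'a::real_inner \<Rightarrow> ereal"
  assumes cvx: "econvex (\<lambda>w. f w - quad c w)"
    and sub: "g \<in> convex_subdiff f x" and a: "f x = ereal a" and b: "f y = ereal b"
  shows "a + g \<bullet> (y - x) + c / 2 * (norm (y - x))\<^sup>2 \<le> b"
proof (rule le_of_le_add_mult_small)
  fix t :: real assume t: "0 < t" "t < 1"
  let ?z = "(1 - t) *\<^sub>R x + t *\<^sub>R y"
  have z: "?z = x + t *\<^sub>R (y - x)" by (simp add: algebra_simps)
  have "f x + ereal (g \<bullet> (?z - x)) \<le> f ?z"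
    using sub unfolding convex_subdiff_def by blast
  then have lo: "ereal (a + t * (g \<bullet> (y - x))) \<le> f ?z"
    unfolding z a by simp
  have "f ?z - quad c ?z \<le> ereal (1 - t) * (f x - quad c x) + ereal t * (f y - quad c y)"
    using cvx t unfolding econvex_def by simp
  then have hi: "f ?z - quad c ?z
      \<le> ereal ((1 - t) * (a - c / 2 * (norm x)\<^sup>2) + t * (b - c / 2 * (norm y)\<^sup>2))"
    by (simp add: a b quad_def)
  obtain e where e: "f ?z = ereal e"
    using lo hi by (cases "f ?z") (auto simp: quad_def)
  \<comment> \<open>Source of the curvature term: after division by \<open>t\<close> it carries the
    factor \<open>1 - t\<close>, which tends to 1.\<close>
  have nz: "(norm ?z)\<^sup>2
      = (1 - t) * (norm x)\<^sup>2 + t * (norm y)\<^sup>2 - t * (1 - t) * (norm (y - x))\<^sup>2"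
    unfolding power2_norm_eq_inner
    by (simp add: inner_add_left inner_add_right inner_diff_left inner_diff_right inner_commute algebra_simps)
  have "a + t * (g \<bullet> (y - x)) \<le> e" using lo e by simp
  moreover have "e - c / 2 * (norm ?z)\<^sup>2
      \<le> (1 - t) * (a - c / 2 * (norm x)\<^sup>2) + t * (b - c / 2 * (norm y)\<^sup>2)"
    using hi e by (simp add: quad_def)
  ultimately have "t * (a + g \<bullet> (y - x) + c / 2 * (norm (y - x))\<^sup>2)
      \<le> t * (b + t * (c / 2 * (norm (y - x))\<^sup>2))"
    unfolding nz by (simp add: field_simps)
  then show "a + g \<bullet> (y - x) + c / 2 * (norm (y - x))\<^sup>2
      \<le> b + t * (c / 2 * (norm (y - x))\<^sup>2)"
    using t by simp
qed

text \<open>Merges the two branches of \<open>subdiff\<close>: for negative \<mu> the bound is the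
  definition expanded, otherwise it is strong convexity.\<close>

lemma curv_class_subdiff_ge:
  assumes f: "f \<in> curv_class \<mu> L" and g: "g \<in> subdiff \<mu> f x"
    and a: "f x = ereal a" and b: "f y = ereal b"
  shows "a + g \<bullet> (y - x) + \<mu> / 2 * (norm (y - x))\<^sup>2 \<le> b"
proof (cases "\<mu> < 0")
  case True
  with g obtain h where h: "h \<in> convex_subdiff (\<lambda>w. f w - quad \<mu> w) x" and gh: "g = h + \<mu> *\<^sub>R x"
    by (auto simp: subdiff_def)
  have "f x - quad \<mu> x + ereal (h \<bullet> (y - x)) \<le> f y - quad \<mu> y"
    using h by (simp add: convex_subdiff_def)
  then show ?thesis
    unfolding a b quad_def gh power2_norm_eq_inner
    by (simp add: inner_add_left inner_add_right inner_diff_left inner_diff_right inner_commute field_simps)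
next
  case False
  with f g show ?thesis
    by (intro strong_convex_subgradient_ge[OF _ _ a b]) (auto simp: subdiff_def curv_class_def)
qed

text \<open>The reflected points \<open>x - t (y - x)\<close> turn the upper bound near \<open>x\<close> into a lower bound at \<open>y\<close>.\<close>

lemma convex_quadratic_upper_imp_min:
  fixes q :: "'a::real_inner \<Rightarrow> real"
  assumes cvx: "convex_on UNIV q"
    and up: "\<And>z. q z \<le> q x + K * (norm (z - x))\<^sup>2"
  shows "q x \<le> q y"
proof (rule le_of_le_add_mult_small)
  fix t :: real assume t: "0 < t" "t < 1"
  let ?z = "x - t *\<^sub>R (y - x)" and ?s = "t / (1 + t)"
  have s: "1 - ?s = 1 / (1 + t)" using t by (simp add: field_simps)
  have "(1 / (1 + t)) *\<^sub>R ?z + ?s *\<^sub>R y = (1 / (1 + t)) *\<^sub>R ((1 + t) *\<^sub>R x)"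
    by (simp add: algebra_simps divide_inverse)
  also have "\<dots> = x" using t by simp
  finally have x: "(1 / (1 + t)) *\<^sub>R ?z + ?s *\<^sub>R y = x" .
  have "q ((1 - ?s) *\<^sub>R ?z + ?s *\<^sub>R y) \<le> (1 - ?s) * q ?z + ?s * q y"
    using t by (intro convex_onD[OF cvx]) auto
  then have "q x \<le> (1 / (1 + t)) * q ?z + ?s * q y" unfolding s x .
  then have "q x \<le> (q ?z + t * q y) / (1 + t)" by (simp add: add_divide_distrib)
  then have "(1 + t) * q x \<le> q ?z + t * q y" using t by (simp add: pos_le_divide_eq mult.commute)
  moreover have "q ?z \<le> q x + K * (t\<^sup>2 * (norm (y - x))\<^sup>2)"
    using up[of ?z] by (simp add: power_mult_distrib)
  ultimately have "t * q x \<le> t * (q y + t * (K * (norm (y - x))\<^sup>2))"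
    by (simp add: algebra_simps power2_eq_square)
  then show "q x \<le> q y + t * (K * (norm (y - x))\<^sup>2)" using t by simp
qed

lemma smooth_subgradient_le:
  fixes f :: "'a::real_inner \<Rightarrow> real"
  assumes cvx: "convex_on UNIV (\<lambda>w. L / 2 * (norm w)\<^sup>2 - f w)"
    and lo: "\<And>z. f x + g \<bullet> (z - x) + \<mu> / 2 * (norm (z - x))\<^sup>2 \<le> f z"
  shows "f y \<le> f x + g \<bullet> (y - x) + L / 2 * (norm (y - x))\<^sup>2"
proof -
  \<comment> \<open>The linear term is chosen so that \<open>q y - q x\<close> is exactly the gap in
    the claim; it remains to see that \<open>x\<close> minimizes \<open>q\<close>.\<close>
  define q where "q w = (L / 2 * (norm w)\<^sup>2 - f w) + (g - L *\<^sub>R x) \<bullet> w" for w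
  have exp: "q z - q x = L / 2 * (norm (z - x))\<^sup>2 - f z + f x + g \<bullet> (z - x)" for z
    unfolding q_def power2_norm_eq_inner
    by (simp add: inner_diff_left inner_diff_right inner_commute field_simps)
  have "convex_on UNIV (\<lambda>w. (g - L *\<^sub>R x) \<bullet> w)"
    by (auto simp: convex_on_def inner_add_right)
  then have "convex_on UNIV q"
    unfolding q_def by (intro convex_on_add cvx)
  moreover have "q z \<le> q x + (L - \<mu>) / 2 * (norm (z - x))\<^sup>2" for z
    using exp[of z] lo[of z] by (simp add: field_simps)
  ultimately have "q x \<le> q y" by (rule convex_quadratic_upper_imp_min)
  with exp[of y] show ?thesis by simp
qed

lemma interpolation_ge:
  fixes f :: "'a::real_inner \<Rightarrow> real"
  assumes "\<mu> < L"
    and cvx: "convex_on UNIV (\<lambda>w. L / 2 * (norm w)\<^sup>2 - f w)"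
    and lo0: "\<And>z. f x0 + g0 \<bullet> (z - x0) + \<mu> / 2 * (norm (z - x0))\<^sup>2 \<le> f z"
    and lo1: "\<And>z. f x1 + g1 \<bullet> (z - x1) + \<mu> / 2 * (norm (z - x1))\<^sup>2 \<le> f z"
  shows "(norm (g1 - g0))\<^sup>2 - 2 * \<mu> * ((g1 - g0) \<bullet> (x1 - x0)) + \<mu> * L * (norm (x1 - x0))\<^sup>2
    \<le> 2 * (L - \<mu>) * (f x1 - f x0 - g0 \<bullet> (x1 - x0))"
proof -
  define M where "M = L - \<mu>"
  have M: "M > 0" and L: "L = M + \<mu>" using assms(1) by (auto simp: M_def)
  define X where "X = x1 - x0"
  define H where "H = g1 - g0 - \<mu> *\<^sub>R X"
  \<comment> \<open>At \<open>x1 - v\<close>, the upper bound from \<open>x1\<close> minus the lower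
    bound from \<open>x0\<close> depends on \<open>v\<close> through
    \<open>M / 2 * (v \<bullet> v) - H \<bullet> v\<close>; this \<open>v\<close> minimizes
    it.\<close>
  define v where "v = (1 / M) *\<^sub>R H"
  have G: "g1 = g0 + H + \<mu> *\<^sub>R X" and H: "H = M *\<^sub>R v"
    using M by (auto simp: H_def v_def)
  have "f x0 + g0 \<bullet> (X - v) + \<mu> / 2 * (norm (X - v))\<^sup>2
      \<le> f x1 + g1 \<bullet> (- v) + L / 2 * (norm v)\<^sup>2"
    using lo0[of "x1 - v"] smooth_subgradient_le[OF cvx lo1, of "x1 - v"]
    by (simp add: X_def algebra_simps)
  then have "M / 2 * (v \<bullet> v) + \<mu> / 2 * (X \<bullet> X) \<le> f x1 - f x0 - g0 \<bullet> X"
    unfolding G H L power2_norm_eq_inner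
    by (simp add: inner_add_left inner_add_right inner_diff_left inner_diff_right inner_commute field_simps)
  then have "2 * M * (M / 2 * (v \<bullet> v) + \<mu> / 2 * (X \<bullet> X)) \<le> 2 * M * (f x1 - f x0 - g0 \<bullet> X)"
    using M by (intro mult_left_mono) auto
  moreover have "2 * M * (M / 2 * (v \<bullet> v) + \<mu> / 2 * (X \<bullet> X))
      = (norm (g1 - g0))\<^sup>2 - 2 * \<mu> * ((g1 - g0) \<bullet> X) + \<mu> * L * (norm X)\<^sup>2"
    unfolding G H L power2_norm_eq_inner
    by (simp add: inner_add_left inner_add_right inner_commute field_simps)
  ultimately show ?thesis by (simp add: X_def M_def)
qed

text \<open>Removes the mixed term \<open>(g1 - g0) \<bullet> (x1 - x0)\<close> from the
  interpolation inequality.\<close>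

lemma hypoconvex_interpolation_ge:
  fixes f :: "'a::real_inner \<Rightarrow> real"
  assumes "\<mu> < L" and "\<mu> \<le> 0" and "0 < L + \<mu>"
    and cvx: "convex_on UNIV (\<lambda>w. L / 2 * (norm w)\<^sup>2 - f w)"
    and lo0: "\<And>z. f x0 + g0 \<bullet> (z - x0) + \<mu> / 2 * (norm (z - x0))\<^sup>2 \<le> f z"
    and lo1: "\<And>z. f x1 + g1 \<bullet> (z - x1) + \<mu> / 2 * (norm (z - x1))\<^sup>2 \<le> f z"
  shows "(norm (g1 - g0))\<^sup>2 + \<mu> * L * (norm (x1 - x0))\<^sup>2
    \<le> 2 * (L + \<mu>) * (f x1 - f x0 - g0 \<bullet> (x1 - x0))"
proof -
  define p where "p = (norm (g1 - g0))\<^sup>2 + \<mu> * L * (norm (x1 - x0))\<^sup>2"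
  define r where "r = (g1 - g0) \<bullet> (x1 - x0)"
  define D where "D = f x1 - f x0 - g0 \<bullet> (x1 - x0)"
  have 1: "p - 2 * \<mu> * r \<le> 2 * (L - \<mu>) * D"
    using interpolation_ge[OF assms(1) cvx lo0 lo1] by (simp add: p_def r_def D_def)
  \<comment> \<open>Exchanging the endpoints keeps \<open>p\<close> and \<open>r\<close> and turns
    \<open>D\<close> into \<open>r - D\<close>, so adding the two inequalities eliminates
    \<open>D\<close>.\<close>
  have "f x0 - f x1 - g1 \<bullet> (x0 - x1) = r - D" "(g0 - g1) \<bullet> (x0 - x1) = r"
    by (simp_all add: r_def D_def algebra_simps)
  then have 2: "p - 2 * \<mu> * r \<le> 2 * (L - \<mu>) * (r - D)"
    using interpolation_ge[OF assms(1) cvx lo1 lo0]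
    by (simp add: p_def norm_minus_commute)
  from 1 2 have "p \<le> (L + \<mu>) * r" by (simp add: algebra_simps)
  \<comment> \<open>With the nonnegative weights \<open>- 2 * \<mu>\<close> here and
    \<open>L + \<mu>\<close> on the first inequality, the terms in \<open>r\<close> cancel.\<close>
  then have "(- 2 * \<mu>) * p \<le> (- 2 * \<mu>) * ((L + \<mu>) * r)"
    using assms(2) by (intro mult_left_mono) auto
  moreover have "(L + \<mu>) * (p - 2 * \<mu> * r) \<le> (L + \<mu>) * (2 * (L - \<mu>) * D)"
    using 1 assms(3) by (intro mult_left_mono) auto
  ultimately have "(L - \<mu>) * p \<le> (L - \<mu>) * (2 * (L + \<mu>) * D)"
    by (simp add: algebra_simps)
  then show ?thesis using assms(1) by (simp add: p_def D_def)
qed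

text \<open>Fermat's rule: minimality of \<open>x'\<close> is the subgradient inequality of
  \<open>f\<^sub>1\<close> rearranged, and for nonnegative \<open>\<mu>\<^sub>1\<close>
  \<open>subdiff\<close> is the convex subdifferential.\<close>

lemma dca_stepE:
  assumes step: "dca_step f\<^sub>1 \<mu>\<^sub>2 f\<^sub>2 x x'" and "proper_fun f\<^sub>1" and "0 \<le> \<mu>\<^sub>1"
  obtains g where "g \<in> subdiff \<mu>\<^sub>2 f\<^sub>2 x" and "g \<in> subdiff \<mu>\<^sub>1 f\<^sub>1 x'"
proof -
  from step obtain g where g: "g \<in> subdiff \<mu>\<^sub>2 f\<^sub>2 x"
    and min: "\<And>y. f\<^sub>1 x' - ereal (g \<bullet> x') \<le> f\<^sub>1 y - ereal (g \<bullet> y)"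
    unfolding dca_step_def is_arg_min_def by (auto simp: not_less)
  have "f\<^sub>1 x' + ereal (g \<bullet> (y - x')) \<le> f\<^sub>1 y" for y
    using min[of y] assms(2)
    by (cases "f\<^sub>1 x'"; cases "f\<^sub>1 y") (auto simp: inner_diff_right)
  with assms(3) have "g \<in> subdiff \<mu>\<^sub>1 f\<^sub>1 x'"
    by (simp add: subdiff_def convex_subdiff_def)
  with g show ?thesis by (rule that)
qed

theorem lemma4:
  fixes f\<^sub>1 f\<^sub>2 :: "real ^ 'd \<Rightarrow> ereal"
    and \<mu>\<^sub>1 \<mu>\<^sub>2 :: real and L\<^sub>1 L\<^sub>2 :: ereal
    and x\<^sub>0 x\<^sub>1 x\<^sub>2 :: "real ^ 'd"
  assumes "dc_assumption \<mu>\<^sub>1 L\<^sub>1 f\<^sub>1 \<mu>\<^sub>2 L\<^sub>2 f\<^sub>2"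
    and "ereal \<mu>\<^sub>1 < L\<^sub>2" and "0 < \<mu>\<^sub>1"
    and "at_curv L\<^sub>2 (\<lambda>L. - L * \<mu>\<^sub>1 / (L + \<mu>\<^sub>1)) \<le> \<mu>\<^sub>2" and "\<mu>\<^sub>2 < 0"
    and "\<mu>\<^sub>1 + \<mu>\<^sub>2 > 0"
    and "x\<^sub>0 \<in> dom_subdiff \<mu>\<^sub>1 f\<^sub>1"
    and "dca_step f\<^sub>1 \<mu>\<^sub>2 f\<^sub>2 x\<^sub>0 x\<^sub>1"
    and "dca_step f\<^sub>1 \<mu>\<^sub>2 f\<^sub>2 x\<^sub>1 x\<^sub>2"
  shows "dc_obj f\<^sub>1 f\<^sub>2 x\<^sub>0 - dc_obj f\<^sub>1 f\<^sub>2 x\<^sub>1 \<ge>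
    ereal (at_curv L\<^sub>2 (\<lambda>L.
      (\<mu>\<^sub>1 + L * \<mu>\<^sub>2 / (L + \<mu>\<^sub>2)) * (1 / 2) * (norm (x\<^sub>0 - x\<^sub>1))\<^sup>2
      + \<mu>\<^sub>1\<^sup>2 / (2 * (L + \<mu>\<^sub>2)) * (norm (x\<^sub>1 - x\<^sub>2))\<^sup>2))"
proof -
  let ?X = "x\<^sub>1 - x\<^sub>0"
  from assms(1) have f1: "f\<^sub>1 \<in> curv_class \<mu>\<^sub>1 L\<^sub>1" and f2: "f\<^sub>2 \<in> curv_class \<mu>\<^sub>2 L\<^sub>2"
    by (auto simp: dc_assumption_def)
  then have p1: "proper_fun f\<^sub>1" and p2: "proper_fun f\<^sub>2" by (auto simp: curv_class_def)
  obtain g0 where g0: "g0 \<in> subdiff \<mu>\<^sub>2 f\<^sub>2 x\<^sub>0" "g0 \<in> subdiff \<mu>\<^sub>1 f\<^sub>1 x\<^sub>1"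
    using dca_stepE[OF assms(8) p1 less_imp_le[OF assms(3)]] .
  obtain g1 where g1: "g1 \<in> subdiff \<mu>\<^sub>2 f\<^sub>2 x\<^sub>1" "g1 \<in> subdiff \<mu>\<^sub>1 f\<^sub>1 x\<^sub>2"
    using dca_stepE[OF assms(9) p1 less_imp_le[OF assms(3)]] .
  \<comment> \<open>A subgradient at \<open>x\<^sub>0\<close> makes
    \<open>f\<^sub>1 x\<^sub>0\<close> finite.\<close>
  obtain h where h: "h \<in> subdiff \<mu>\<^sub>1 f\<^sub>1 x\<^sub>0" using assms(7) by (auto simp: dom_subdiff_def)
  obtain a0 a1 a2 where a: "f\<^sub>1 x\<^sub>0 = ereal a0" "f\<^sub>1 x\<^sub>1 = ereal a1" "f\<^sub>1 x\<^sub>2 = ereal a2"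
    using subdiff_finite[OF p1 h] subdiff_finite[OF p1 g0(2)] subdiff_finite[OF p1 g1(2)]
    by (metis ereal_real')
  obtain b0 b1 where b: "f\<^sub>2 x\<^sub>0 = ereal b0" "f\<^sub>2 x\<^sub>1 = ereal b1"
    using subdiff_finite[OF p2 g0(1)] subdiff_finite[OF p2 g1(1)]
    by (metis ereal_real')
  have A: "- (g0 \<bullet> ?X) + \<mu>\<^sub>1 / 2 * (norm ?X)\<^sup>2 \<le> a0 - a1"
    using curv_class_subdiff_ge[OF f1 g0(2) a(2) a(1)]
    by (simp add: inner_diff_right norm_minus_commute algebra_simps)
  \<comment> \<open>With \<open>A\<close> settling \<open>f\<^sub>1\<close>, only the linearization
    error of \<open>f\<^sub>2\<close> at \<open>x\<^sub>0\<close> is left to bound from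
    below.\<close>
  have goal: "?thesis" if "at_curv L\<^sub>2 (\<lambda>L.
      (\<mu>\<^sub>1 + L * \<mu>\<^sub>2 / (L + \<mu>\<^sub>2)) * (1 / 2) * (norm (x\<^sub>0 - x\<^sub>1))\<^sup>2
      + \<mu>\<^sub>1\<^sup>2 / (2 * (L + \<mu>\<^sub>2)) * (norm (x\<^sub>1 - x\<^sub>2))\<^sup>2)
      \<le> \<mu>\<^sub>1 / 2 * (norm ?X)\<^sup>2 + (b1 - b0 - g0 \<bullet> ?X)"
    using that A by (simp add: dc_obj_def a b)
  show ?thesis
  proof (cases L\<^sub>2)
    case PInf
    \<comment> \<open>In the limit the term in \<open>x\<^sub>1 - x\<^sub>2\<close>
      vanishes.\<close>
    have "g0 \<bullet> ?X + \<mu>\<^sub>2 / 2 * (norm ?X)\<^sup>2 \<le> b1 - b0"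
      using curv_class_subdiff_ge[OF f2 g0(1) b] by simp
    then show ?thesis
      unfolding PInf
      by (intro goal[unfolded PInf], subst at_curv_infinity_decrease)
        (simp add: norm_minus_commute[of x\<^sub>0] field_simps)
  next
    case MInf
    with assms(2) show ?thesis by simp
  next
    case (real L)
    have L: "\<mu>\<^sub>2 < L" "0 < L + \<mu>\<^sub>2" using assms(2,5,6) real by auto
    define f where "f x = real_of_ereal (f\<^sub>2 x)" for x
    have f: "f\<^sub>2 x = ereal (f x)" for x
      using f2 real by (auto simp: f_def curv_class_def ereal_real)
    have lo: "f x + g \<bullet> (z - x) + \<mu>\<^sub>2 / 2 * (norm (z - x))\<^sup>2 \<le> f z"
      if "g \<in> subdiff \<mu>\<^sub>2 f\<^sub>2 x" for g x z
      using curv_class_subdiff_ge[OF f2 that f f] .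
    have "econvex (\<lambda>x. quad L x - f\<^sub>2 x)" using f2 real by (simp add: curv_class_def)
    then have cvx: "convex_on UNIV (\<lambda>w. L / 2 * (norm w)\<^sup>2 - f w)"
      by (intro convex_onI) (auto simp: econvex_def quad_def f)
    have D: "(norm (g1 - g0))\<^sup>2 + \<mu>\<^sub>2 * L * (norm ?X)\<^sup>2 \<le> 2 * (L + \<mu>\<^sub>2) * (b1 - b0 - g0 \<bullet> ?X)"
      using hypoconvex_interpolation_ge[OF L(1) less_imp_le[OF assms(5)] L(2) cvx
          lo[OF g0(1)] lo[OF g1(1)]] b f by simp
    \<comment> \<open>Strong monotonicity: the function values cancel when the bounds from
      \<open>x\<^sub>1\<close> and from \<open>x\<^sub>2\<close> are added.\<close>
    have "\<mu>\<^sub>1 * (norm (x\<^sub>1 - x\<^sub>2))\<^sup>2 \<le> (g1 - g0) \<bullet> (x\<^sub>2 - x\<^sub>1)"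
      using curv_class_subdiff_ge[OF f1 g0(2) a(2) a(3)] curv_class_subdiff_ge[OF f1 g1(2) a(3) a(2)]
      by (simp add: inner_diff_left inner_diff_right norm_minus_commute algebra_simps)
    also have "\<dots> \<le> norm (g1 - g0) * norm (x\<^sub>1 - x\<^sub>2)"
      by (metis norm_cauchy_schwarz norm_minus_commute)
    finally have "\<mu>\<^sub>1 * norm (x\<^sub>1 - x\<^sub>2) \<le> norm (g1 - g0)"
      by (cases "x\<^sub>1 = x\<^sub>2") (auto simp: power2_eq_square)
    then have "(\<mu>\<^sub>1 * norm (x\<^sub>1 - x\<^sub>2))\<^sup>2 \<le> (norm (g1 - g0))\<^sup>2"
      using assms(3) by (intro power_mono) auto
    with D have "\<mu>\<^sub>1\<^sup>2 * (norm (x\<^sub>1 - x\<^sub>2))\<^sup>2 + \<mu>\<^sub>2 * L * (norm ?X)\<^sup>2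
        \<le> 2 * (L + \<mu>\<^sub>2) * (b1 - b0 - g0 \<bullet> ?X)"
      by (simp add: power_mult_distrib)
    then have "(\<mu>\<^sub>1\<^sup>2 * (norm (x\<^sub>1 - x\<^sub>2))\<^sup>2 + \<mu>\<^sub>2 * L * (norm ?X)\<^sup>2) / (2 * (L + \<mu>\<^sub>2))
        \<le> b1 - b0 - g0 \<bullet> ?X"
      using L(2) by (simp add: pos_divide_le_eq mult.commute)
    moreover have "(\<mu>\<^sub>1 + L * \<mu>\<^sub>2 / (L + \<mu>\<^sub>2)) * (1 / 2) * (norm (x\<^sub>0 - x\<^sub>1))\<^sup>2
        + \<mu>\<^sub>1\<^sup>2 / (2 * (L + \<mu>\<^sub>2)) * (norm (x\<^sub>1 - x\<^sub>2))\<^sup>2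
        = \<mu>\<^sub>1 / 2 * (norm ?X)\<^sup>2
        + (\<mu>\<^sub>1\<^sup>2 * (norm (x\<^sub>1 - x\<^sub>2))\<^sup>2 + \<mu>\<^sub>2 * L * (norm ?X)\<^sup>2) / (2 * (L + \<mu>\<^sub>2))"
      by (simp add: norm_minus_commute[of x\<^sub>0] add_divide_distrib distrib_left mult_ac)
    ultimately show ?thesis by (intro goal) (simp add: real)
  qed
qed

end
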